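(* Let $A:\mathrm{Hol}(\mathbb{D})\to\mathrm{Hol}(\mathbb{D})$ be linear. The following assertions are equivalent: (i) there exists a holomorphic map $\varphi:\mathbb{D}\to\mathbb{D}$ such that $A=C_\varphi$; (ii) $A$ is an algebra homomorphism different from $0$; (iii) $A$ is continuous and $Ae_n=(Ae_1)^n$ for all $n\in\mathbb{N}_0$.
   Context: $\mathbb{D}$ is the open unit disc and $\mathrm{Hol}(\mathbb{D})$ the algebra of holomorphic functions on $\mathbb{D}$, a Fréchet space for the topology of uniform convergence on compact subsets. $C_\varphi f=f\circ\varphi$. $e_n(z)=z^n$ for $z\in\mathbb{D}$, $n\in\mathbb{N}_0=\{0,1,2,\dots\}$. An algebra homomorphism $A:\mathrm{Hol}(\mathbb{D})\to\mathrm{Hol}(\mathbb{D})$ is a linear map with $A(f\cdot g)=A(f)\cdot A(g)$ for all $f,g$ (continuity and $Ae_0=e_0$ are not required). *)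

theory Defs
  imports "HOL-Complex_Analysis.Complex_Analysis"
begin

abbreviation unit_disc :: "complex set" ("\<bbbD>") where
  "\<bbbD> \<equiv> ball 0 1"

text \<open>
  An element of Hol(D) is a function on the disc only. HOL functions are total, so each such
  function is represented by its extension by 0 outside the disc; equality in the type
  \<open>hol_disc\<close> is then equality on the disc.
\<close>

typedef hol_disc = "{f :: complex \<Rightarrow> complex. f holomorphic_on \<bbbD> \<and> (\<forall>z. z \<notin> \<bbbD> \<longrightarrow> f z = 0)}"
  morphisms hol_eval Abs_hol_disc
  by (rule exI[of _ "\<lambda>_. 0"]) auto

setup_lifting type_definition_hol_disc

lemma hol_eval_holomorphic: "hol_eval f holomorphic_on \<bbbD>"
  using hol_eval[of f] by simp

lemma hol_eval_outside: "z \<notin> \<bbbD> \<Longrightarrow> hol_eval f z = 0"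
  using hol_eval[of f] by simp

lemma hol_disc_eqI: "(\<And>z. z \<in> \<bbbD> \<Longrightarrow> hol_eval f z = hol_eval g z) \<Longrightarrow> f = g"
  by (subst hol_eval_inject[symmetric], rule ext) (metis hol_eval_outside)

text \<open>The element of Hol(D) given by \<open>g\<close>; meaningful only if \<open>g\<close> is holomorphic on the disc.\<close>

definition hol_of :: "(complex \<Rightarrow> complex) \<Rightarrow> hol_disc" where
  "hol_of g = Abs_hol_disc (\<lambda>z. if z \<in> \<bbbD> then g z else 0)"

lemma hol_eval_hol_of:
  assumes "g holomorphic_on \<bbbD>"
  shows "hol_eval (hol_of g) z = (if z \<in> \<bbbD> then g z else 0)"
proof -
  have "(\<lambda>z. if z \<in> \<bbbD> then g z else 0) holomorphic_on \<bbbD>"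
    using assms by (rule holomorphic_transform) auto
  then show ?thesis
    unfolding hol_of_def by (subst Abs_hol_disc_inverse) auto
qed

instantiation hol_disc :: comm_ring_1
begin

lift_definition zero_hol_disc :: hol_disc is "\<lambda>_. 0" by auto

lift_definition one_hol_disc :: hol_disc is "\<lambda>z. if z \<in> \<bbbD> then 1 else 0"
  by (auto intro: holomorphic_transform[of "\<lambda>_. 1"])

lift_definition uminus_hol_disc :: "hol_disc \<Rightarrow> hol_disc" is "\<lambda>f z. - f z"
  by (auto intro: holomorphic_intros)

lift_definition plus_hol_disc :: "hol_disc \<Rightarrow> hol_disc \<Rightarrow> hol_disc" is "\<lambda>f g z. f z + g z"
  by (auto intro: holomorphic_intros)

lift_definition minus_hol_disc :: "hol_disc \<Rightarrow> hol_disc \<Rightarrow> hol_disc" is "\<lambda>f g z. f z - g z"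
  by (auto intro: holomorphic_intros)

lift_definition times_hol_disc :: "hol_disc \<Rightarrow> hol_disc \<Rightarrow> hol_disc" is "\<lambda>f g z. f z * g z"
  by (auto intro: holomorphic_intros)

instance
proof
  show "(0 :: hol_disc) \<noteq> 1"
    by transfer (auto simp: fun_eq_iff intro!: exI[of _ 0])
qed (transfer; force simp: fun_eq_iff algebra_simps)+

end

lift_definition hol_scale :: "complex \<Rightarrow> hol_disc \<Rightarrow> hol_disc" is "\<lambda>c f z. c * f z"
  by (auto intro: holomorphic_intros)

lemma vector_space_hol_scale: "vector_space hol_scale"
  by (unfold_locales; transfer; simp add: fun_eq_iff algebra_simps)

lemma hol_eval_power: "z \<in> \<bbbD> \<Longrightarrow> hol_eval (f ^ n) z = hol_eval f z ^ n"
  by (induction n) (auto simp: one_hol_disc.rep_eq times_hol_disc.rep_eq)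

text \<open>
  The topology of uniform convergence on compact subsets of the disc: basic neighbourhoods of
  \<open>f\<close> consist of the \<open>g\<close> with \<open>\<bar>g - f\<bar> < \<epsilon>\<close> on a compact set \<open>K\<close>.
\<close>

instantiation hol_disc :: topological_space
begin

definition open_hol_disc :: "hol_disc set \<Rightarrow> bool" where
  "open_hol_disc U \<longleftrightarrow>
     (\<forall>f\<in>U. \<exists>K \<epsilon>. compact K \<and> K \<subseteq> \<bbbD> \<and> 0 < \<epsilon> \<and>
        (\<forall>g. (\<forall>z\<in>K. dist (hol_eval g z) (hol_eval f z) < \<epsilon>) \<longrightarrow> g \<in> U))"

instance
proof
  show "open (UNIV :: hol_disc set)"
    unfolding open_hol_disc_def by (intro ballI exI[of _ "{}"] exI[of _ 1]) simp
next
  fix S T :: "hol_disc set"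
  assume S: "open S" and T: "open T"
  show "open (S \<inter> T)"
    unfolding open_hol_disc_def
  proof
    fix f assume f: "f \<in> S \<inter> T"
    obtain K \<epsilon> where 1: "compact K" "K \<subseteq> \<bbbD>" "0 < \<epsilon>"
      "\<forall>g. (\<forall>z\<in>K. dist (hol_eval g z) (hol_eval f z) < \<epsilon>) \<longrightarrow> g \<in> S"
      using bspec[OF S[unfolded open_hol_disc_def] IntD1[OF f]]
      by (elim exE conjE) (rule that)
    obtain L \<delta> where 2: "compact L" "L \<subseteq> \<bbbD>" "0 < \<delta>"
      "\<forall>g. (\<forall>z\<in>L. dist (hol_eval g z) (hol_eval f z) < \<delta>) \<longrightarrow> g \<in> T"
      using bspec[OF T[unfolded open_hol_disc_def] IntD2[OF f]]
      by (elim exE conjE) (rule that)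
    show "\<exists>K \<epsilon>. compact K \<and> K \<subseteq> \<bbbD> \<and> 0 < \<epsilon> \<and>
        (\<forall>g. (\<forall>z\<in>K. dist (hol_eval g z) (hol_eval f z) < \<epsilon>) \<longrightarrow> g \<in> S \<inter> T)"
    proof (intro exI conjI allI impI)
      show "compact (K \<union> L)" "K \<union> L \<subseteq> \<bbbD>" "0 < min \<epsilon> \<delta>"
        using 1(1-3) 2(1-3) by (simp_all add: compact_Un)
      fix g assume "\<forall>z\<in>K \<union> L. dist (hol_eval g z) (hol_eval f z) < min \<epsilon> \<delta>"
      then show "g \<in> S \<inter> T"
        using 1(4) 2(4) by simp
    qed
  qed
next
  fix \<U> :: "hol_disc set set"
  assume *: "\<forall>S\<in>\<U>. open S"
  show "open (\<Union>\<U>)"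
    unfolding open_hol_disc_def
  proof
    fix f assume "f \<in> \<Union>\<U>"
    then obtain S where S: "S \<in> \<U>" "f \<in> S" by blast
    with * have "open S" by blast
    obtain K \<epsilon> where K: "compact K" "K \<subseteq> \<bbbD>" "0 < \<epsilon>"
      "\<forall>g. (\<forall>z\<in>K. dist (hol_eval g z) (hol_eval f z) < \<epsilon>) \<longrightarrow> g \<in> S"
      using bspec[OF \<open>open S\<close>[unfolded open_hol_disc_def] S(2)]
      by (elim exE conjE) (rule that)
    with S show "\<exists>K \<epsilon>. compact K \<and> K \<subseteq> \<bbbD> \<and> 0 < \<epsilon> \<and>
        (\<forall>g. (\<forall>z\<in>K. dist (hol_eval g z) (hol_eval f z) < \<epsilon>) \<longrightarrow> g \<in> \<Union>\<U>)"
      by (intro exI[of _ K] exI[of _ \<epsilon>]) (simp, blast)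
  qed
qed

end

lemma open_hol_nbhd:
  assumes "compact K" "K \<subseteq> \<bbbD>"
  shows "open {g. \<exists>r<\<epsilon>. \<forall>z\<in>K. dist (hol_eval g z) (hol_eval f z) \<le> r}"
  unfolding open_hol_disc_def
proof
  fix g assume "g \<in> {g. \<exists>r<\<epsilon>. \<forall>z\<in>K. dist (hol_eval g z) (hol_eval f z) \<le> r}"
  then obtain r where r: "r < \<epsilon>" "\<And>z. z \<in> K \<Longrightarrow> dist (hol_eval g z) (hol_eval f z) \<le> r"
    by blast
  define \<delta> where "\<delta> = (\<epsilon> - r) / 2"
  have \<delta>: "0 < \<delta>" "r + \<delta> < \<epsilon>" using r(1) by (auto simp: \<delta>_def field_simps)
  have "dist (hol_eval h z) (hol_eval f z) \<le> r + \<delta>"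
    if "\<forall>z\<in>K. dist (hol_eval h z) (hol_eval g z) < \<delta>" "z \<in> K" for h z
    using that r(2)[of z] dist_triangle[of "hol_eval h z" "hol_eval f z" "hol_eval g z"]
    by fastforce
  with \<delta> assms show "\<exists>L \<delta>. compact L \<and> L \<subseteq> \<bbbD> \<and> 0 < \<delta> \<and>
      (\<forall>h. (\<forall>z\<in>L. dist (hol_eval h z) (hol_eval g z) < \<delta>) \<longrightarrow>
        h \<in> {g. \<exists>r<\<epsilon>. \<forall>z\<in>K. dist (hol_eval g z) (hol_eval f z) \<le> r})"
    by (intro exI[of _ K] exI[of _ \<delta>]) blast
qed

lemma tendsto_hol_disc_iff:
  "(F \<longlongrightarrow> f) \<F> \<longleftrightarrow>
     (\<forall>K. compact K \<and> K \<subseteq> \<bbbD> \<longrightarrow> uniform_limit K (\<lambda>i. hol_eval (F i)) (hol_eval f) \<F>)"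
proof (intro iffI allI impI)
  fix K assume lim: "(F \<longlongrightarrow> f) \<F>" and K: "compact K \<and> K \<subseteq> \<bbbD>"
  show "uniform_limit K (\<lambda>i. hol_eval (F i)) (hol_eval f) \<F>"
  proof (rule uniform_limitI)
    fix \<epsilon> :: real assume "0 < \<epsilon>"
    then have "f \<in> {g. \<exists>r<\<epsilon>. \<forall>z\<in>K. dist (hol_eval g z) (hol_eval f z) \<le> r}"
      by (auto intro!: exI[of _ 0])
    then have "\<forall>\<^sub>F i in \<F>. F i \<in> {g. \<exists>r<\<epsilon>. \<forall>z\<in>K. dist (hol_eval g z) (hol_eval f z) \<le> r}"
      using topological_tendstoD[OF lim] open_hol_nbhd K by blast
    then show "\<forall>\<^sub>F i in \<F>. \<forall>z\<in>K. dist (hol_eval (F i) z) (hol_eval f z) < \<epsilon>"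
      by (rule eventually_mono) fastforce
  qed
next
  assume *: "\<forall>K. compact K \<and> K \<subseteq> \<bbbD> \<longrightarrow> uniform_limit K (\<lambda>i. hol_eval (F i)) (hol_eval f) \<F>"
  show "(F \<longlongrightarrow> f) \<F>"
  proof (rule topological_tendstoI)
    fix U assume U: "open U" "f \<in> U"
    obtain K \<epsilon> where K: "compact K" "K \<subseteq> \<bbbD>" "0 < \<epsilon>"
      "\<forall>g. (\<forall>z\<in>K. dist (hol_eval g z) (hol_eval f z) < \<epsilon>) \<longrightarrow> g \<in> U"
      using bspec[OF U(1)[unfolded open_hol_disc_def] U(2)]
      by (elim exE conjE) (rule that)
    have "uniform_limit K (\<lambda>i. hol_eval (F i)) (hol_eval f) \<F>"
      using * K(1,2) by simp
    then have "\<forall>\<^sub>F i in \<F>. \<forall>z\<in>K. dist (hol_eval (F i) z) (hol_eval f z) < \<epsilon>"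
      using K(3) by (rule uniform_limitD)
    then show "\<forall>\<^sub>F i in \<F>. F i \<in> U"
      by (rule eventually_mono) (use K(4) in simp)
  qed
qed

abbreviation hol_linear :: "(hol_disc \<Rightarrow> hol_disc) \<Rightarrow> bool" where
  "hol_linear \<equiv> Vector_Spaces.linear hol_scale hol_scale"

definition algebra_hom :: "(hol_disc \<Rightarrow> hol_disc) \<Rightarrow> bool" where
  "algebra_hom A \<longleftrightarrow> hol_linear A \<and> (\<forall>f g. A (f * g) = A f * A g)"

definition monomial :: "nat \<Rightarrow> hol_disc" where
  "monomial n = hol_of (\<lambda>z. z ^ n)"

definition composition_operator :: "(complex \<Rightarrow> complex) \<Rightarrow> hol_disc \<Rightarrow> hol_disc" where
  "composition_operator \<phi> f = hol_of (hol_eval f \<circ> \<phi>)"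

lemma hol_eval_monomial: "z \<in> \<bbbD> \<Longrightarrow> hol_eval (monomial n) z = z ^ n"
  unfolding monomial_def by (subst hol_eval_hol_of) (auto intro: holomorphic_intros)

lemma hol_eval_composition_operator:
  assumes "\<phi> holomorphic_on \<bbbD>" "\<phi> \<in> \<bbbD> \<rightarrow> \<bbbD>" "z \<in> \<bbbD>"
  shows "hol_eval (composition_operator \<phi> f) z = hol_eval f (\<phi> z)"
proof -
  have "hol_eval f \<circ> \<phi> holomorphic_on \<bbbD>"
    using assms hol_eval_holomorphic by (intro holomorphic_on_compose_gen) auto
  with assms show ?thesis
    unfolding composition_operator_def by (simp add: hol_eval_hol_of)
qed

end

theory Submission
  imports Defs
begin

text \<open>
  A nonzero algebra homomorphism \<open>A\<close> is unital, since the idempotent \<open>A 1\<close> is constant on the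
  connected disc. Put \<open>\<phi> = A e\<^sub>1\<close>. If \<open>\<phi> z \<notin> \<bbbD>\<close>, then \<open>e\<^sub>1 - \<phi> z\<close> would be
  invertible although its image vanishes at \<open>z\<close>; so \<open>\<phi>\<close> maps into the disc. Dividing
  \<open>f - f (\<phi> z)\<close> by \<open>e\<^sub>1 - \<phi> z\<close> and applying \<open>A\<close> shows \<open>A f z = f (\<phi> z)\<close>, and no
  continuity is needed. Conversely, if \<open>A\<close> is continuous and multiplicative on monomials, then
  \<open>e\<^sub>n \<rightarrow> 0\<close> gives \<open>\<phi>\<^sup>n \<rightarrow> 0\<close> pointwise, hence \<open>\<bar>\<phi>\<bar> < 1\<close>, and \<open>A\<close> agrees with the composition
  operator on Taylor polynomials, which are dense.
\<close>

section \<open>Algebra in Hol(D): idempotents, division by a linear factor, invertibility\<close>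

lemmas hol_eval_simps =
  zero_hol_disc.rep_eq one_hol_disc.rep_eq plus_hol_disc.rep_eq minus_hol_disc.rep_eq
  times_hol_disc.rep_eq hol_scale.rep_eq

lemma hol_eval_sum: "hol_eval (\<Sum>i\<in>I. F i) z = (\<Sum>i\<in>I. hol_eval (F i) z)"
  by (induction I rule: infinite_finite_induct) (simp_all add: hol_eval_simps)

text \<open>The values lie in {0, 1}, and a continuous function with finite range on a connected set
  is constant.\<close>

lemma hol_disc_idempotent:
  fixes f :: hol_disc
  assumes "f * f = f"
  shows "f = 0 \<or> f = 1"
proof -
  have 01: "hol_eval f z = 0 \<or> hol_eval f z = 1" for z
  proof -
    have "hol_eval f z * hol_eval f z = hol_eval f z"
      using assms times_hol_disc.rep_eq[of f f] by metis
    then show ?thesis by simp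
  qed
  have "hol_eval f constant_on \<bbbD>"
  proof (rule continuous_finite_range_constant)
    show "continuous_on \<bbbD> (hol_eval f)"
      using hol_eval_holomorphic by (rule holomorphic_on_imp_continuous_on)
    have "hol_eval f ` \<bbbD> \<subseteq> {0, 1}" using 01 by blast
    then show "finite (hol_eval f ` \<bbbD>)" by (rule finite_subset) simp
  qed simp
  then obtain c where c: "\<And>z. z \<in> \<bbbD> \<Longrightarrow> hol_eval f z = c"
    unfolding constant_on_def by blast
  have "c = 0 \<or> c = 1" using 01[of 0] c[of 0] by simp
  then show ?thesis
    by (auto intro!: hol_disc_eqI simp: c hol_eval_simps)
qed

lemma hol_disc_division:
  assumes "a \<in> \<bbbD>"
  obtains g where "f = hol_scale (hol_eval f a) 1 + (monomial 1 - hol_scale a 1) * g"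
proof -
  \<comment> \<open>The identity holds at \<open>a\<close> whatever \<open>g\<close> is there; the
    derivative is the value that removes the singularity of the difference quotient and makes
    \<open>g\<close> holomorphic.\<close>
  define g where "g = hol_of (\<lambda>z. if z = a then deriv (hol_eval f) a
    else (hol_eval f z - hol_eval f a) / (z - a))"
  have g: "hol_eval g z = (if z = a then deriv (hol_eval f) a
    else (hol_eval f z - hol_eval f a) / (z - a))" if "z \<in> \<bbbD>" for z
    unfolding g_def using that
    by (subst hol_eval_hol_of) (auto intro: pole_lemma_open hol_eval_holomorphic)
  show thesis
    by (rule that[of g], rule hol_disc_eqI)
      (auto simp: hol_eval_simps hol_eval_monomial g)
qed

text \<open>The only pole of 1/(z - a) lies outside the disc.\<close>

lemma monomial_1_minus_const_invertible:
  assumes "a \<notin> \<bbbD>"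
  obtains g where "(monomial 1 - hol_scale a 1) * g = 1"
proof -
  define g where "g = hol_of (\<lambda>z. inverse (z - a))"
  have g: "hol_eval g z = inverse (z - a)" if "z \<in> \<bbbD>" for z
    unfolding g_def using that assms
    by (subst hol_eval_hol_of) (auto intro!: holomorphic_intros)
  have "hol_eval ((monomial 1 - hol_scale a 1) * g) z = hol_eval 1 z" if z: "z \<in> \<bbbD>" for z
  proof -
    have "z - a \<noteq> 0" using z assms by auto
    with z show ?thesis
      by (simp add: hol_eval_simps hol_eval_monomial g del: mem_ball_0)
  qed
  then show thesis by (intro that[of g] hol_disc_eqI)
qed

section \<open>Convergence in Hol(D): evaluations, monomials, Taylor polynomials\<close>

lemma compact_subset_unit_disc_cball:
  assumes "compact K" "K \<subseteq> \<bbbD>"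
  obtains r where "0 \<le> r" "r < 1" "K \<subseteq> cball 0 r"
proof (cases "K = {}")
  case False
  \<comment> \<open>The norm attains its maximum over \<open>K\<close> at a point of
    \<open>K\<close>, so this maximum is below 1.\<close>
  then obtain w where w: "w \<in> K" "\<And>z. z \<in> K \<Longrightarrow> norm z \<le> norm w"
    using continuous_attains_sup[of K norm] assms(1) by (auto intro: continuous_intros)
  show thesis
    by (rule that[of "norm w"]) (use w assms in auto)
qed (use that[of 0] in auto)

text \<open>A single point of the disc is a compact set; outside the disc every evaluation is
  0.\<close>

lemma tendsto_hol_eval:
  assumes "(F \<longlongrightarrow> f) \<F>"
  shows "((\<lambda>i. hol_eval (F i) z) \<longlongrightarrow> hol_eval f z) \<F>"
proof (cases "z \<in> \<bbbD>")
  case True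
  then have "uniform_limit {z} (\<lambda>i. hol_eval (F i)) (hol_eval f) \<F>"
    using assms unfolding tendsto_hol_disc_iff
    by (metis compact_sing empty_subsetI insert_subset)
  then show ?thesis by (rule tendsto_uniform_limitI) simp
qed (simp add: hol_eval_outside)

lemma monomial_tendsto_0: "monomial \<longlonglongrightarrow> 0"
  unfolding tendsto_hol_disc_iff
proof (intro allI impI)
  fix K assume K: "compact K \<and> K \<subseteq> \<bbbD>"
  then obtain r where r: "0 \<le> r" "r < 1" "K \<subseteq> cball 0 r"
    using compact_subset_unit_disc_cball by blast
  show "uniform_limit K (\<lambda>n. hol_eval (monomial n)) (hol_eval 0) sequentially"
  proof (rule uniform_limitI)
    fix e :: real assume "0 < e"
    then have "\<forall>\<^sub>F n in sequentially. r ^ n < e"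
      using order_tendstoD(2)[OF LIMSEQ_realpow_zero[OF r(1,2)]] by simp
    then show "\<forall>\<^sub>F n in sequentially. \<forall>z\<in>K. dist (hol_eval (monomial n) z) (hol_eval 0 z) < e"
    proof (rule eventually_mono, intro ballI)
      fix n z assume "r ^ n < e" "z \<in> K"
      moreover have "norm z ^ n \<le> r ^ n" "z \<in> \<bbbD>"
        using \<open>z \<in> K\<close> r(3) K by (force intro!: power_mono)+
      ultimately show "dist (hol_eval (monomial n) z) (hol_eval 0 z) < e"
        by (simp add: hol_eval_monomial hol_eval_simps norm_power del: mem_ball_0)
    qed
  qed
qed

definition taylor_coeff :: "hol_disc \<Rightarrow> nat \<Rightarrow> complex" where
  "taylor_coeff f n = (deriv ^^ n) (hol_eval f) 0 / fact n"

lemma taylor_coeff_sums: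
  assumes "z \<in> \<bbbD>"
  shows "(\<lambda>n. taylor_coeff f n * z ^ n) sums hol_eval f z"
  using holomorphic_power_series[OF hol_eval_holomorphic assms]
  by (simp add: taylor_coeff_def)

lemma taylor_polynomials_tendsto:
  "(\<lambda>n. \<Sum>i<n. hol_scale (taylor_coeff f i) (monomial i)) \<longlonglongrightarrow> f"
  unfolding tendsto_hol_disc_iff
proof (intro allI impI)
  fix K assume K: "compact K \<and> K \<subseteq> \<bbbD>"
  then obtain r where r: "0 \<le> r" "r < 1" "K \<subseteq> cball 0 r"
    using compact_subset_unit_disc_cball by blast
  \<comment> \<open>Convergence of the Taylor series at \<open>s\<close> puts the radius of
    convergence at \<open>s\<close> or above, hence strictly above \<open>r\<close>, which gives
    uniform convergence on \<open>cball 0 r\<close>.\<close>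
  obtain s where s: "r < s" "s < 1" using r(2) dense by blast
  have "summable (\<lambda>n. taylor_coeff f n * of_real s ^ n)"
    using taylor_coeff_sums[of "of_real s" f] s r by (auto simp: sums_iff)
  from conv_radius_geI[OF this] have "ereal s \<le> conv_radius (taylor_coeff f)"
    using s r by simp
  with s have "ereal r < conv_radius (taylor_coeff f)"
    using less_le_trans[of "ereal r" "ereal s"] by simp
  from powser_uniform_limit[OF this, of 0]
  have "uniform_limit K (\<lambda>n z. \<Sum>i<n. taylor_coeff f i * z ^ i)
    (\<lambda>z. \<Sum>i. taylor_coeff f i * z ^ i) sequentially"
    using r(3) by (auto intro: uniform_limit_on_subset)
  then show "uniform_limit K
    (\<lambda>n. hol_eval (\<Sum>i<n. hol_scale (taylor_coeff f i) (monomial i))) (hol_eval f) sequentially"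
  proof (rule uniform_limit_cong'[THEN iffD1, rotated 2])
    fix z assume "z \<in> K"
    then have "z \<in> \<bbbD>" using K by blast
    then show "(\<Sum>i. taylor_coeff f i * z ^ i) = hol_eval f z"
      using taylor_coeff_sums by (simp add: sums_iff del: mem_ball_0)
    show "(\<Sum>i<n. taylor_coeff f i * z ^ i) =
        hol_eval (\<Sum>i<n. hol_scale (taylor_coeff f i) (monomial i)) z" for n
      using \<open>z \<in> \<bbbD>\<close> by (simp add: hol_eval_sum hol_eval_simps hol_eval_monomial del: mem_ball_0)
  qed
qed

section \<open>Composition operators: multiplicativity and continuity\<close>

context
  fixes \<phi> :: "complex \<Rightarrow> complex"
  assumes \<phi>: "\<phi> holomorphic_on \<bbbD>" "\<phi> \<in> \<bbbD> \<rightarrow> \<bbbD>"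
begin

lemma algebra_hom_composition_operator: "algebra_hom (composition_operator \<phi>)"
  unfolding algebra_hom_def Vector_Spaces.linear_iff
  by (auto intro!: vector_space_hol_scale hol_disc_eqI
      simp: hol_eval_composition_operator[OF \<phi>] hol_eval_simps simp del: mem_ball_0)

text \<open>Used to see that a composition operator is not the zero map.\<close>

lemma composition_operator_1: "composition_operator \<phi> 1 = 1"
  using \<phi>(2)
  by (auto intro!: hol_disc_eqI simp: hol_eval_composition_operator[OF \<phi>] hol_eval_simps Pi_iff
      simp del: mem_ball_0)

lemma composition_operator_monomial:
  "composition_operator \<phi> (monomial n) = composition_operator \<phi> (monomial 1) ^ n"
proof (rule hol_disc_eqI)
  fix z assume z: "z \<in> \<bbbD>"
  then have "\<phi> z \<in> \<bbbD>" using \<phi>(2) by blast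
  with z show "hol_eval (composition_operator \<phi> (monomial n)) z =
      hol_eval (composition_operator \<phi> (monomial 1) ^ n) z"
    by (simp add: hol_eval_composition_operator[OF \<phi>] hol_eval_power hol_eval_monomial
        del: mem_ball_0)
qed

text \<open>The image of a compact \<open>K\<close> under \<open>\<phi>\<close> is compact in the
  disc, and closeness of \<open>g\<close> to \<open>f\<close> on that image is closeness of the
  composites on \<open>K\<close>.\<close>

lemma continuous_on_composition_operator: "continuous_on UNIV (composition_operator \<phi>)"
  unfolding continuous_on_def
proof
  fix f :: hol_disc
  have id: "((\<lambda>g. g) \<longlongrightarrow> f) (at f)" by (rule tendsto_ident_at)
  have "uniform_limit K (\<lambda>g. hol_eval (composition_operator \<phi> g))
    (hol_eval (composition_operator \<phi> f)) (at f)" if K: "compact K" "K \<subseteq> \<bbbD>" for K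
  proof -
    have "continuous_on K \<phi>"
      using holomorphic_on_imp_continuous_on[OF \<phi>(1)] K(2) by (rule continuous_on_subset)
    then have "compact (\<phi> ` K)" using K(1) by (rule compact_continuous_image)
    moreover have "\<phi> ` K \<subseteq> \<bbbD>" using \<phi>(2) K(2) by blast
    ultimately have "uniform_limit (\<phi> ` K) hol_eval (hol_eval f) (at f)"
      using id unfolding tendsto_hol_disc_iff by blast
    then have "uniform_limit K (\<lambda>g z. hol_eval g (\<phi> z)) (\<lambda>z. hol_eval f (\<phi> z)) (at f)"
      by (rule uniform_limit_compose') simp
    then show ?thesis
      by (rule uniform_limit_cong'[THEN iffD1, rotated 2])
        (use K(2) in \<open>auto simp: hol_eval_composition_operator[OF \<phi>] simp del: mem_ball_0\<close>)
  qed
  then show "(composition_operator \<phi> \<longlongrightarrow> composition_operator \<phi> f) (at f within UNIV)"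
    unfolding tendsto_hol_disc_iff by blast
qed

end

section \<open>Recognising composition operators\<close>

lemma composition_operatorI:
  assumes "\<And>z. z \<in> \<bbbD> \<Longrightarrow> hol_eval \<phi> z \<in> \<bbbD>"
    and "\<And>f z. z \<in> \<bbbD> \<Longrightarrow> hol_eval (A f) z = hol_eval f (hol_eval \<phi> z)"
  shows "\<exists>\<phi>. \<phi> holomorphic_on \<bbbD> \<and> \<phi> \<in> \<bbbD> \<rightarrow> \<bbbD> \<and> A = composition_operator \<phi>"
proof (intro exI conjI)
  \<comment> \<open>The symbol is taken from Hol(D) itself, so it is holomorphic from the
    start.\<close>
  show h: "hol_eval \<phi> holomorphic_on \<bbbD>" by (rule hol_eval_holomorphic)
  show maps: "hol_eval \<phi> \<in> \<bbbD> \<rightarrow> \<bbbD>" using assms(1) by blast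
  show "A = composition_operator (hol_eval \<phi>)"
    by (intro ext hol_disc_eqI)
      (simp add: hol_eval_composition_operator[OF h maps] assms(2) del: mem_ball_0)
qed

lemma algebra_hom_unital:
  assumes "algebra_hom A" "A \<noteq> (\<lambda>_. 0)"
  shows "A 1 = 1"
proof -
  have mult: "A (f * g) = A f * A g" for f g
    using assms(1) by (simp add: algebra_hom_def)
  have "A 1 \<noteq> 0"
  proof
    assume "A 1 = 0"
    then have "A f = 0" for f using mult[of f 1] by simp
    with assms(2) show False by blast
  qed
  then show ?thesis using hol_disc_idempotent[of "A 1"] mult[of 1 1] by simp
qed

lemma algebra_hom_imp_composition_operator:
  assumes "algebra_hom A" "A \<noteq> (\<lambda>_. 0)"
  shows "\<exists>\<phi>. \<phi> holomorphic_on \<bbbD> \<and> \<phi> \<in> \<bbbD> \<rightarrow> \<bbbD> \<and> A = composition_operator \<phi>"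
proof -
  interpret Vector_Spaces.linear hol_scale hol_scale A
    using assms(1) by (simp add: algebra_hom_def)
  have mult: "A (f * g) = A f * A g" for f g
    using assms(1) by (simp add: algebra_hom_def)
  note one = algebra_hom_unital[OF assms]
  \<comment> \<open>Applying \<open>A\<close> and then evaluating at \<open>z\<close> is a character
    of Hol(D). It sends the first monomial to w = \<open>hol_eval (A (monomial 1)) z\<close>, so it
    kills the ideal generated by that monomial minus w.\<close>
  have vanish: "hol_eval (A ((monomial 1 - hol_scale (hol_eval (A (monomial 1)) z) 1) * g)) z = 0"
    if "z \<in> \<bbbD>" for z g
    using that by (simp add: mult diff scale one hol_eval_simps del: mem_ball_0)
  have maps: "hol_eval (A (monomial 1)) z \<in> \<bbbD>" if z: "z \<in> \<bbbD>" for z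
  proof (rule ccontr)
    assume "hol_eval (A (monomial 1)) z \<notin> \<bbbD>"
    then obtain g where "(monomial 1 - hol_scale (hol_eval (A (monomial 1)) z) 1) * g = 1"
      by (rule monomial_1_minus_const_invertible)
    with vanish[OF z, of g] z show False
      by (simp add: one one_hol_disc.rep_eq del: mem_ball_0)
  qed
  have "hol_eval (A f) z = hol_eval f (hol_eval (A (monomial 1)) z)" if z: "z \<in> \<bbbD>" for f z
  proof -
    let ?w = "hol_eval (A (monomial 1)) z"
    obtain g where g: "f = hol_scale (hol_eval f ?w) 1 + (monomial 1 - hol_scale ?w 1) * g"
      using hol_disc_division[OF maps[OF z]] .
    have "A f = hol_scale (hol_eval f ?w) 1 + A ((monomial 1 - hol_scale ?w 1) * g)"
      by (subst g) (simp add: add scale one)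
    then show ?thesis
      using vanish[OF z, of g] z by (simp add: hol_eval_simps del: mem_ball_0)
  qed
  then show ?thesis using maps by (intro composition_operatorI)
qed

lemma continuous_imp_composition_operator:
  assumes "hol_linear A" "continuous_on UNIV A"
    and monomial: "\<And>n. A (monomial n) = A (monomial 1) ^ n"
  shows "\<exists>\<phi>. \<phi> holomorphic_on \<bbbD> \<and> \<phi> \<in> \<bbbD> \<rightarrow> \<bbbD> \<and> A = composition_operator \<phi>"
proof -
  interpret Vector_Spaces.linear hol_scale hol_scale A by (rule assms(1))
  have lim: "(\<lambda>n. hol_eval (A (F n)) z) \<longlonglongrightarrow> hol_eval (A f) z" if "F \<longlonglongrightarrow> f" for F f z
    using continuous_on_tendsto_compose[OF assms(2) that] by (intro tendsto_hol_eval) simp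
  have maps: "hol_eval (A (monomial 1)) z \<in> \<bbbD>" if z: "z \<in> \<bbbD>" for z
  proof -
    have "(\<lambda>n. hol_eval (A (monomial n)) z) \<longlonglongrightarrow> 0"
      using lim[OF monomial_tendsto_0, of z] by (simp add: zero zero_hol_disc.rep_eq)
    then have "(\<lambda>n. hol_eval (A (monomial 1)) z ^ n) \<longlonglongrightarrow> 0"
      using z by (subst (asm) monomial) (simp add: hol_eval_power del: mem_ball_0)
    then have "(\<lambda>n. norm (hol_eval (A (monomial 1)) z) ^ n) \<longlonglongrightarrow> 0"
      by (simp add: tendsto_norm_zero_iff flip: norm_power)
    then have "\<forall>\<^sub>F n in sequentially. norm (hol_eval (A (monomial 1)) z) ^ n < 1"
      by (rule order_tendstoD) simp
    \<comment> \<open>One such \<open>n\<close> is enough: a number of modulus at least 1 has all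
      its powers of modulus at least 1.\<close>
    then obtain n where "norm (hol_eval (A (monomial 1)) z) ^ n < 1"
      using eventually_happens by fastforce
    then show ?thesis
      using one_le_power[of "norm (hol_eval (A (monomial 1)) z)" n] unfolding mem_ball_0 by linarith
  qed
  have "hol_eval (A f) z = hol_eval f (hol_eval (A (monomial 1)) z)" if z: "z \<in> \<bbbD>" for f z
  \<comment> \<open>The Taylor partial sums at \<open>?w\<close> have two limits: one by continuity
    of \<open>A\<close>, the other by the Taylor series, which converges at \<open>?w\<close>
    because \<open>?w\<close> lies in the disc. The case n = 0 of \<open>monomial\<close> takes care
    of the constant term.\<close>
  proof (rule LIMSEQ_unique)
    let ?w = "hol_eval (A (monomial 1)) z"
    have "hol_eval (A (\<Sum>i<n. hol_scale (taylor_coeff f i) (monomial i))) z =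
        (\<Sum>i<n. taylor_coeff f i * ?w ^ i)" for n
      unfolding sum scale hol_eval_sum hol_scale.rep_eq
      using z by (subst monomial) (simp add: hol_eval_power del: mem_ball_0)
    then show "(\<lambda>n. \<Sum>i<n. taylor_coeff f i * ?w ^ i) \<longlonglongrightarrow> hol_eval (A f) z"
      using lim[OF taylor_polynomials_tendsto, of f z] by simp
    show "(\<lambda>n. \<Sum>i<n. taylor_coeff f i * ?w ^ i) \<longlonglongrightarrow> hol_eval f ?w"
      using taylor_coeff_sums[OF maps[OF z]] unfolding sums_def .
  qed
  then show ?thesis using maps by (intro composition_operatorI)
qed

theorem proposition2p1:
  fixes A :: "hol_disc \<Rightarrow> hol_disc"
  assumes "hol_linear A"
  shows "((\<exists>\<phi>. \<phi> holomorphic_on \<bbbD> \<and> \<phi> \<in> \<bbbD> \<rightarrow> \<bbbD> \<and> A = composition_operator \<phi>)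
            \<longleftrightarrow> (algebra_hom A \<and> A \<noteq> (\<lambda>_. 0)))
       \<and> ((algebra_hom A \<and> A \<noteq> (\<lambda>_. 0))
            \<longleftrightarrow> (continuous_on UNIV A \<and> (\<forall>n. A (monomial n) = A (monomial 1) ^ n)))"
    (is "(?i \<longleftrightarrow> ?ii) \<and> (?ii \<longleftrightarrow> ?iii)")
proof -
  have "?i \<Longrightarrow> ?ii"
    using algebra_hom_composition_operator composition_operator_1
    by (metis zero_neq_one)
  moreover have "?ii \<Longrightarrow> ?i"
    using algebra_hom_imp_composition_operator by blast
  moreover have "?i \<Longrightarrow> ?iii"
    using continuous_on_composition_operator composition_operator_monomial by blast
  moreover have "?iii \<Longrightarrow> ?i"
    using continuous_imp_composition_operator[OF assms] by blast
  ultimately show ?thesis by argo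
qed

end
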